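(* Let $g$ solve system (S3) with initial data $h_{ii}>0$, $h_{11}\le h_{22}\le h_{33}$, and suppose $h\in D_\infty$, i.e. along the solution of the planar system (P) starting at $(h_{00}^{1/3}h_{22},h_{00}^{1/3}h_{33})$ one has $b,c\to\infty$. Then the solution of (S3) exists for all $t\ge0$ and as $t\to\infty$: $g_{00}\to0$, $g_{11}\to 0$, $g_{22},g_{33}\to\infty$, and $g_{33}-g_{22}\to0$.
   Context: Let $\det h = h_{00}h_{11}h_{22}h_{33}$, $\beta=\frac{1}{6(\det h)^2}$, $p(x,y,z) = x^4 - x^3(y+z) + x^2yz + x(-y^3+y^2z+yz^2-z^3) + y^4 - y^3z - yz^3 + z^4$, $q(x,y,z) = 5x^4 - 3x^3(y+z) + x^2yz + x(y^3-y^2z-yz^2+z^3) - 3y^4 + 3y^3z + 3yz^3 - 3z^4$, $r(x,y,z) = \tfrac12(p+3q)(x,y,z) = 8x^4-5x^3(y+z)+2x^2yz+x(y^3-y^2z-yz^2+z^3)-4y^4+4y^3z+4yz^3-4z^4$. System (S3): $\dot g_{00} = -\beta\,p(g_{11},g_{22},g_{33})\,g_{00}^3$, $\dot g_{11} = -\beta\,q(g_{11},g_{22},g_{33})\,g_{00}^2g_{11}$, $\dot g_{22} = -\beta\,q(g_{22},g_{33},g_{11})\,g_{00}^2g_{22}$, $\dot g_{33} = -\beta\,q(g_{33},g_{11},g_{22})\,g_{00}^2g_{33}$, $g_{ii}(0)=h_{ii}$ (Bach flow on $\mathbb{R}\times\mathbb{S}^3$ in a diagonalizing frame; $g_{00}g_{11}g_{22}g_{33}=\det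 h$ is preserved). Set $a=g_{00}^{1/3}g_{11}$, $b=g_{00}^{1/3}g_{22}$, $c=g_{00}^{1/3}g_{33}$, so $abc=\det h$. Under (S3), $(b,c)$ follows, up to a time reparametrization, the planar system (P): $\dot b=-\tfrac23 r(b,a,c)\,b$, $\dot c=-\tfrac23 r(c,a,b)\,c$ with $a=\det h/(bc)$, on the region $a\le b\le c$. $D_\infty$ denotes the set of initial metrics whose (P)-trajectory has $b,c\to\infty$. *)

theory Defs
  imports "HOL-Analysis.Analysis"
begin

definition pp :: "real \<Rightarrow> real \<Rightarrow> real \<Rightarrow> real" where
  "pp x y z = x^4 - x^3*(y+z) + x^2*y*z + x*(-(y^3) + y^2*z + y*z^2 - z^3)
              + y^4 - y^3*z - y*z^3 + z^4"

definition qq :: "real \<Rightarrow> real \<Rightarrow> real \<Rightarrow> real" where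
  "qq x y z = 5*x^4 - 3*x^3*(y+z) + x^2*y*z + x*(y^3 - y^2*z - y*z^2 + z^3)
              - 3*y^4 + 3*y^3*z + 3*y*z^3 - 3*z^4"

definition rr :: "real \<Rightarrow> real \<Rightarrow> real \<Rightarrow> real" where
  "rr x y z = (pp x y z + 3 * qq x y z) / 2"

definition bach_beta :: "real \<Rightarrow> real" where
  "bach_beta D = 1 / (6 * D^2)"

definition S3_solution ::
  "real \<Rightarrow> real \<Rightarrow> real \<Rightarrow> real \<Rightarrow> real set \<Rightarrow>
   (real \<Rightarrow> real) \<Rightarrow> (real \<Rightarrow> real) \<Rightarrow> (real \<Rightarrow> real) \<Rightarrow> (real \<Rightarrow> real) \<Rightarrow> bool" where
  "S3_solution h0 h1 h2 h3 I g0 g1 g2 g3 \<longleftrightarrow>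
     (let \<beta> = bach_beta (h0*h1*h2*h3) in
     g0 0 = h0 \<and> g1 0 = h1 \<and> g2 0 = h2 \<and> g3 0 = h3 \<and>
     (\<forall>t\<in>I.
        (g0 has_real_derivative (- \<beta> * pp (g1 t) (g2 t) (g3 t) * (g0 t)^3)) (at t within I) \<and>
        (g1 has_real_derivative (- \<beta> * qq (g1 t) (g2 t) (g3 t) * (g0 t)^2 * g1 t)) (at t within I) \<and>
        (g2 has_real_derivative (- \<beta> * qq (g2 t) (g3 t) (g1 t) * (g0 t)^2 * g2 t)) (at t within I) \<and>
        (g3 has_real_derivative (- \<beta> * qq (g3 t) (g1 t) (g2 t) * (g0 t)^2 * g3 t)) (at t within I)))"

definition P_solution ::
  "real \<Rightarrow> real \<Rightarrow> real \<Rightarrow> real set \<Rightarrow> (real \<Rightarrow> real) \<Rightarrow> (real \<Rightarrow> real) \<Rightarrow> bool" where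
  "P_solution D b0 c0 I b c \<longleftrightarrow>
     b 0 = b0 \<and> c 0 = c0 \<and>
     (\<forall>t\<in>I.
        (b has_real_derivative (- (2/3) * rr (b t) (D / (b t * c t)) (c t) * b t)) (at t within I) \<and>
        (c has_real_derivative (- (2/3) * rr (c t) (D / (b t * c t)) (b t) * c t)) (at t within I))"

text \<open>D_infinity: the (P)-trajectory starting at (h0^(1/3) h2, h0^(1/3) h3) has b, c \<rightarrow> \<infinity>,
  either on a maximal interval [0,T) with T finite, or on [0,\<infinity>).\<close>
definition D_infty :: "real \<Rightarrow> real \<Rightarrow> real \<Rightarrow> real \<Rightarrow> bool" where
  "D_infty h0 h1 h2 h3 \<longleftrightarrow>
     (let D = h0*h1*h2*h3; b0 = root 3 h0 * h2; c0 = root 3 h0 * h3 in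
      (\<exists>b c. P_solution D b0 c0 {0..} b c \<and>
             filterlim b at_top at_top \<and> filterlim c at_top at_top) \<or>
      (\<exists>T>0. \<exists>b c. P_solution D b0 c0 {0..<T} b c \<and>
             filterlim b at_top (at_left T) \<and> filterlim c at_top (at_left T)))"

end

theory Submission
  imports Defs
begin

text \<open>
  Given an escaping trajectory $(b,c)$ of (P), put $a = D/(bc)$ and $p = p(a,b,c)$, and let $k$ be
  the solution of $k' = -\frac13 p k$ with $k(0) = h_{00}^{1/3}$. Then $g_{00} = k^3$,
  $g_{11} = a/k$, $g_{22} = b/k$, $g_{33} = c/k$ solves (S3) in the time $t$ with
  $ds/dt = \beta k^2$, and this is the only solution.

  Once $b$ and $c$ are large, $(\ln bc)' = \frac23 r(a,b,c) \le (8 + 2D)\,\frac23 a$ while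
  $p \ge aD/2$. Since $a \le 1$ eventually, the first bound excludes escape in finite (P)-time.
  Comparing both bounds, $\int p$ dominates a multiple of $\ln bc$, so $k \to 0$, and hence
  $t \to \infty$ together with $s$.
  The gap $x = c - b$ satisfies $x' = -\frac23 W x$ with a rate $W$ that exceeds both
  $\frac12 p + \frac32$ and $\frac94 (b^2 + bc + c^2)$. The former makes $x/k$ decay exponentially;
  the latter gives $(-\ln(a/k) - x^2)' \ge aD/2$, so $a/k \to 0$.
\<close>

section \<open>Differential inequalities\<close>

lemma gronwall_inequality:
  fixes u u' :: "real \<Rightarrow> real"
  assumes "a \<le> b"
    and deriv: "\<And>t. t \<in> {a..b} \<Longrightarrow> (u has_real_derivative u' t) (at t within {a..b})"
    and growth: "\<And>t. t \<in> {a..b} \<Longrightarrow> u' t \<le> K * u t"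
  shows "u b \<le> u a * exp (K * (b - a))"
proof -
  let ?v = "\<lambda>t. u t * exp (- K * t)"
  have deriv_v: "(?v has_real_derivative (u' t - K * u t) * exp (- K * t)) (at t within {a..b})"
    if "t \<in> {a..b}" for t
    by (rule derivative_eq_intros deriv that | simp add: algebra_simps)+
  obtain t where "t \<in> {a..b}" and mvt: "?v b - ?v a = (u' t - K * u t) * exp (- K * t) * (b - a)"
    using mvt_very_simple[OF assms(1), of ?v "\<lambda>t. (*) ((u' t - K * u t) * exp (- K * t))"] deriv_v
    by (auto simp: has_field_derivative_def)
  have "?v b - ?v a \<le> 0"
    unfolding mvt using growth[OF \<open>t \<in> {a..b}\<close>] assms(1) by (intro mult_nonpos_nonneg) auto
  then have "?v b * exp (K * b) \<le> ?v a * exp (K * b)"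
    by simp
  then show ?thesis
    by (simp add: mult.assoc right_diff_distrib flip: exp_add)
qed

lemma eventually_gronwall:
  fixes u u' :: "real \<Rightarrow> real"
  assumes "\<forall>\<^sub>F t in at_top. (u has_real_derivative u' t) (at t)"
    and "\<forall>\<^sub>F t in at_top. u' t \<le> K * u t"
  obtains C where "\<forall>\<^sub>F t in at_top. u t \<le> C * exp (K * t)"
proof -
  obtain s where tail: "\<And>t. s \<le> t \<Longrightarrow> (u has_real_derivative u' t) (at t) \<and> u' t \<le> K * u t"
    using eventually_conj[OF assms] unfolding eventually_at_top_linorder by blast
  have "u t \<le> u s * exp (- K * s) * exp (K * t)" if "s \<le> t" for t
    using gronwall_inequality[OF that, of u u' K] tail
    by (simp add: has_field_derivative_at_within right_diff_distrib mult.assoc flip: exp_add)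
  then show thesis
    by (intro that[of "u s * exp (- K * s)"] eventually_at_top_linorderI)
qed

lemma filterlim_at_top_deriv_mono:
  fixes f g :: "real \<Rightarrow> real"
  assumes "filterlim f at_top at_top"
    and "\<forall>\<^sub>F t in at_top. (f has_real_derivative f' t) (at t)"
    and "\<forall>\<^sub>F t in at_top. (g has_real_derivative g' t) (at t)"
    and "\<forall>\<^sub>F t in at_top. f' t \<le> g' t"
  shows "filterlim g at_top at_top"
proof -
  have "\<forall>\<^sub>F t in at_top. ((\<lambda>t. f t - g t) has_real_derivative f' t - g' t) (at t)"
    using assms(2,3) by eventually_elim (rule DERIV_diff)
  moreover have "\<forall>\<^sub>F t in at_top. f' t - g' t \<le> 0 * (f t - g t)"
    using assms(4) by eventually_elim simp
  ultimately obtain C where "\<forall>\<^sub>F t in at_top. f t - g t \<le> C * exp (0 * t)"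
    by (rule eventually_gronwall)
  then have "\<forall>\<^sub>F t in at_top. - C + f t \<le> g t"
    by eventually_elim simp
  then show ?thesis
    by (rule filterlim_at_top_mono[rotated])
      (rule filterlim_tendsto_add_at_top[OF tendsto_const assms(1)])
qed

lemma eventually_has_real_derivative_at:
  assumes "\<And>s. a \<le> s \<Longrightarrow> (f has_real_derivative f' s) (at s within {a..})"
  shows "\<forall>\<^sub>F s in at_top. (f has_real_derivative f' s) (at s)"
  using eventually_gt_at_top[of a]
proof eventually_elim
  case (elim s)
  then show ?case using assms[of s] at_within_interior[of s "{a..}"] by simp
qed

lemma integral_has_real_derivative_atLeast:
  fixes f :: "real \<Rightarrow> real"
  assumes "continuous_on {a..} f" "a \<le> t"
  shows "((\<lambda>t. integral {a..t} f) has_real_derivative f t) (at t within {a..})"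
proof -
  have "((\<lambda>t. integral {a..t} f) has_real_derivative f t) (at t within {a..t+1})"
    using assms by (intro integral_has_real_derivative) (auto intro: continuous_on_subset)
  moreover have "at t within {a..t+1} = at t within {a..}"
    using assms by (intro at_within_nhd[of t "{..<t+1}"]) auto
  ultimately show ?thesis by simp
qed

lemma bounded_atLeast_if_tendsto:
  fixes f :: "real \<Rightarrow> 'a::real_normed_vector"
  assumes "continuous_on {a..} f" "(f \<longlongrightarrow> l) at_top"
  shows "bounded (f ` {a..})"
proof -
  have "\<forall>\<^sub>F t in at_top. norm (f t) < norm l + 1"
    using tendsto_norm[OF assms(2)] by (rule order_tendstoD) simp
  then obtain N where tail: "\<And>t. N \<le> t \<Longrightarrow> norm (f t) < norm l + 1"
    unfolding eventually_at_top_linorder by blast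
  have "compact (f ` {a..N})"
    using assms(1) by (intro compact_continuous_image) (auto intro: continuous_on_subset)
  moreover have "bounded (f ` {N..})"
    using tail unfolding bounded_iff by (auto intro!: exI[of _ "norm l + 1"] less_imp_le)
  ultimately have "bounded (f ` ({a..N} \<union> {N..}))"
    by (simp add: compact_imp_bounded image_Un)
  then show ?thesis
    by (rule bounded_subset) auto
qed

lemma deriv_ge_imp_expanding:
  fixes f f' :: "real \<Rightarrow> real"
  assumes "\<And>x. (f has_real_derivative f' x) (at x)" "\<And>x. \<kappa> \<le> f' x" "x \<le> y"
  shows "\<kappa> * (y - x) \<le> f y - f x"
proof -
  have "((\<lambda>x. f x - \<kappa> * x) has_real_derivative f' x - \<kappa>) (at x)" for x
    by (rule DERIV_diff[OF assms(1) DERIV_cmult_Id])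
  then have "f x - \<kappa> * x \<le> f y - \<kappa> * y"
    using assms(2) by (intro DERIV_nonneg_imp_nondecreasing[OF assms(3)]) fastforce
  then show ?thesis by (simp add: algebra_simps)
qed

lemma deriv_ge_imp_bij:
  fixes f f' :: "real \<Rightarrow> real"
  assumes deriv: "\<And>x. (f has_real_derivative f' x) (at x)" and "0 < \<kappa>" "\<And>x. \<kappa> \<le> f' x"
  shows "strict_mono f" "surj f"
proof -
  note expanding = deriv_ge_imp_expanding[OF deriv assms(3)]
  show "strict_mono f"
  proof (rule strict_monoI)
    fix x y :: real assume "x < y"
    then have "0 < \<kappa> * (y - x)" using assms(2) by simp
    then show "f x < f y" using expanding[of x y] \<open>x < y\<close> by simp
  qed
  have "\<exists>x. y = f x" for y
  proof -
    define r where "r = \<bar>y - f 0\<bar> / \<kappa>"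
    have "0 \<le> r" "\<kappa> * r = \<bar>y - f 0\<bar>" using assms(2) by (simp_all add: r_def)
    then have "\<exists>x\<ge>- r. x \<le> r \<and> f x = y"
      using expanding[of 0 r] expanding[of "- r" 0] deriv by (intro IVT) (auto intro: DERIV_isCont)
    then show ?thesis by blast
  qed
  then show "surj f" unfolding surj_def by blast
qed

lemma deriv_ge_imp_deriv_inv:
  fixes f f' :: "real \<Rightarrow> real"
  assumes deriv: "\<And>x. (f has_real_derivative f' x) (at x)" and "0 < \<kappa>" "\<And>x. \<kappa> \<le> f' x"
  shows "(inv f has_real_derivative 1 / f' (inv f y)) (at y)"
proof -
  note bij = deriv_ge_imp_bij[OF assms]
  have inv_f: "inv f (f x) = x" for x
    using bij(1) by (simp add: strict_mono_imp_inj_on)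
  have f_inv: "f (inv f y) = y" for y
    using bij(2) by (rule surj_f_inv_f)
  have "isCont (inv f) (f (inv f y))"
    by (rule isCont_inverse_function[where d = 1]) (simp_all add: inv_f DERIV_isCont[OF deriv])
  then have "(inv f has_real_derivative inverse (f' (inv f y))) (at y)"
    using assms(2) assms(3)[of "inv f y"]
    by (intro DERIV_inverse_function[where f = f and a = "y - 1" and b = "y + 1"])
      (auto simp: deriv f_inv)
  then show ?thesis by (simp add: inverse_eq_divide)
qed

lemma time_change:
  fixes \<phi> :: "real \<Rightarrow> real"
  assumes "continuous_on {0..} \<phi>" "0 < \<kappa>" "\<And>s. 0 \<le> s \<Longrightarrow> \<kappa> \<le> \<phi> s"
  obtains \<sigma> where "\<sigma> 0 = 0" "\<And>t. 0 \<le> t \<Longrightarrow> 0 \<le> \<sigma> t"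
    "\<And>t. 0 \<le> t \<Longrightarrow> (\<sigma> has_real_derivative 1 / \<phi> (\<sigma> t)) (at t within {0..})"
    "filterlim \<sigma> at_top at_top"
proof -
  define \<psi> where "\<psi> s = \<phi> (max 0 s)" for s
  have "continuous_on UNIV \<psi>"
    unfolding \<psi>_def by (rule continuous_on_compose2[OF assms(1)]) (auto intro!: continuous_intros)
  then obtain F where deriv_F: "\<And>s. (F has_real_derivative \<psi> s) (at s)"
    using einterval_antiderivative[of "-\<infinity>" "\<infinity>" \<psi>]
    by (auto simp: continuous_on_eq_continuous_at has_real_derivative_iff_has_vector_derivative)
  define \<tau> where "\<tau> s = F s - F 0" for s
  have deriv_\<tau>: "(\<tau> has_real_derivative \<psi> s) (at s)" for s
    unfolding \<tau>_def[abs_def] by (rule derivative_eq_intros deriv_F | simp)+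
  have \<psi>_ge: "\<kappa> \<le> \<psi> s" for s using assms(3) by (simp add: \<psi>_def)
  note bij = deriv_ge_imp_bij[OF deriv_\<tau> assms(2) \<psi>_ge]
  have le_inv: "s \<le> inv \<tau> t" if "\<tau> s \<le> t" for s t
    using that bij by (metis strict_mono_less_eq surj_f_inv_f)
  have "\<tau> 0 = 0" by (simp add: \<tau>_def)
  then have nonneg: "0 \<le> inv \<tau> t" if "0 \<le> t" for t using le_inv that by simp
  show thesis
  proof
    show "inv \<tau> 0 = 0" using \<open>\<tau> 0 = 0\<close> bij(1) by (metis inv_f_f strict_mono_imp_inj_on)
    show "(inv \<tau> has_real_derivative 1 / \<phi> (inv \<tau> t)) (at t within {0..})" if "0 \<le> t" for t
      using deriv_ge_imp_deriv_inv[OF deriv_\<tau> assms(2) \<psi>_ge, of t] nonneg[OF that]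
      by (simp add: \<psi>_def max_def has_field_derivative_at_within)
    show "filterlim (inv \<tau>) at_top at_top"
      unfolding filterlim_at_top eventually_at_top_linorder using le_inv by blast
  qed (rule nonneg)
qed

section \<open>Ordinary differential equations\<close>

lemma ode_time_change:
  fixes x :: "real \<Rightarrow> 'a::real_normed_vector"
  assumes "continuous_on {0..} \<phi>" "0 < \<kappa>" "\<And>s. 0 \<le> s \<Longrightarrow> \<kappa> \<le> \<phi> s"
    and deriv_x: "\<And>s. 0 \<le> s \<Longrightarrow> (x has_vector_derivative \<phi> s *\<^sub>R F (x s)) (at s within {0..})"
  obtains \<sigma> where "\<sigma> 0 = 0" "filterlim \<sigma> at_top at_top"
    "\<And>t. 0 \<le> t \<Longrightarrow> ((\<lambda>t. x (\<sigma> t)) has_vector_derivative F (x (\<sigma> t))) (at t within {0..})"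
proof -
  obtain \<sigma> where \<sigma>: "\<sigma> 0 = 0" "\<And>t. 0 \<le> t \<Longrightarrow> 0 \<le> \<sigma> t"
    "\<And>t. 0 \<le> t \<Longrightarrow> (\<sigma> has_real_derivative 1 / \<phi> (\<sigma> t)) (at t within {0..})"
    "filterlim \<sigma> at_top at_top"
    using time_change[OF assms(1-3)] by blast
  have "((\<lambda>t. x (\<sigma> t)) has_vector_derivative F (x (\<sigma> t))) (at t within {0..})" if "0 \<le> t" for t
  proof -
    have "(x has_vector_derivative \<phi> (\<sigma> t) *\<^sub>R F (x (\<sigma> t))) (at (\<sigma> t) within \<sigma> ` {0..})"
      using deriv_x[OF \<sigma>(2)[OF that]]
      by (rule has_vector_derivative_within_subset) (use \<sigma>(2) in auto)
    with \<sigma>(3)[OF that] have "((\<lambda>t. x (\<sigma> t)) has_vector_derivative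
        (1 / \<phi> (\<sigma> t)) *\<^sub>R \<phi> (\<sigma> t) *\<^sub>R F (x (\<sigma> t))) (at t within {0..})"
      unfolding has_real_derivative_iff_has_vector_derivative
      using vector_diff_chain_within[unfolded o_def] by blast
    moreover have "\<phi> (\<sigma> t) \<noteq> 0" using assms(2,3) \<sigma>(2)[OF that] by (metis not_le)
    ultimately show ?thesis by simp
  qed
  then show thesis using that \<sigma>(1,4) by blast
qed

lemma lipschitz_on_mult_bounded:
  fixes f g :: "'a::metric_space \<Rightarrow> 'b::real_normed_algebra"
  assumes "C-lipschitz_on S f" "D-lipschitz_on S g"
    and "\<And>x. x \<in> S \<Longrightarrow> norm (f x) \<le> M" "\<And>x. x \<in> S \<Longrightarrow> norm (g x) \<le> N"
    and "0 \<le> M" "0 \<le> N"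
  shows "(M * D + C * N)-lipschitz_on S (\<lambda>x. f x * g x)"
proof (rule lipschitz_onI)
  fix x y assume in_S: "x \<in> S" "y \<in> S"
  have "f x * g x - f y * g y = f x * (g x - g y) + (f x - f y) * g y"
    by (simp add: algebra_simps)
  then have "norm (f x * g x - f y * g y) \<le>
      norm (f x) * norm (g x - g y) + norm (f x - f y) * norm (g y)"
    by (metis add_mono norm_mult_ineq norm_triangle_le)
  also have "\<dots> \<le> M * (D * dist x y) + C * dist x y * N"
    using assms in_S lipschitz_onD[OF assms(1) in_S] lipschitz_onD[OF assms(2) in_S]
    by (intro add_mono mult_mono) (auto simp: dist_norm lipschitz_on_nonneg)
  finally show "dist (f x * g x) (f y * g y) \<le> (M * D + C * N) * dist x y"
    by (simp add: dist_norm algebra_simps)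
next
  show "0 \<le> M * D + C * N"
    using assms by (simp add: lipschitz_on_nonneg)
qed

lemma real_polynomial_function_lipschitz_on:
  fixes p :: "'a::{real_normed_vector,heine_borel} \<Rightarrow> real"
  assumes "real_polynomial_function p" "bounded S"
  shows "\<exists>L. L-lipschitz_on S p"
  using assms(1)
proof (induction p)
  case (linear f)
  then show ?case by (meson bounded_linear.lipschitz_boundE)
next
  case (const c)
  show ?case using lipschitz_on_constant by blast
next
  case (add f g)
  then show ?case using lipschitz_on_add by blast
next
  case (mult f g)
  then obtain C D where lipschitz: "C-lipschitz_on S f" "D-lipschitz_on S g" by blast
  have "bounded (f ` S)" "bounded (g ` S)"
    using lipschitz assms(2)
    by (meson bounded_uniformly_continuous_image lipschitz_on_uniformly_continuous)+
  then obtain M N where "0 < M" "\<And>x. x \<in> S \<Longrightarrow> norm (f x) \<le> M"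
    "0 < N" "\<And>x. x \<in> S \<Longrightarrow> norm (g x) \<le> N"
    unfolding bounded_pos by (metis imageI)
  then show ?case
    using lipschitz_on_mult_bounded[OF lipschitz] by (metis less_imp_le)
qed

lemma ode_unique:
  fixes x y :: "real \<Rightarrow> 'a::real_inner"
  assumes lipschitz: "\<And>S. bounded S \<Longrightarrow> \<exists>L. L-lipschitz_on S F"
    and deriv_x: "\<And>t. 0 \<le> t \<Longrightarrow> (x has_vector_derivative F (x t)) (at t within {0..})"
    and deriv_y: "\<And>t. 0 \<le> t \<Longrightarrow> (y has_vector_derivative F (y t)) (at t within {0..})"
    and "x 0 = y 0" "0 \<le> t"
  shows "x t = y t"
proof -
  let ?z = "\<lambda>s. x s - y s"
  have "bounded (u ` {0..t})"
    if "\<And>t. 0 \<le> t \<Longrightarrow> (u has_vector_derivative F (u t)) (at t within {0..})" for u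
  proof (intro compact_imp_bounded compact_continuous_image compact_Icc)
    show "continuous_on {0..t} u"
      by (rule continuous_on_vector_derivative[OF has_vector_derivative_within_subset[OF that]])
        auto
  qed
  then have "bounded (x ` {0..t} \<union> y ` {0..t})" using deriv_x deriv_y by simp
  then obtain L where L_lipschitz: "L-lipschitz_on (x ` {0..t} \<union> y ` {0..t}) F"
    using lipschitz by blast
  have "(norm (?z t))\<^sup>2 \<le> (norm (?z 0))\<^sup>2 * exp (2 * L * (t - 0))"
  proof (rule gronwall_inequality[OF assms(5)])
    fix s assume s: "s \<in> {0..t}"
    have "(?z has_vector_derivative F (x s) - F (y s)) (at s within {0..t})"
      using s by (intro has_vector_derivative_diff has_vector_derivative_within_subset[OF deriv_x]
          has_vector_derivative_within_subset[OF deriv_y]) auto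
    note deriv_z = this[unfolded has_vector_derivative_def]
    show "((\<lambda>s. (norm (?z s))\<^sup>2) has_real_derivative 2 * (?z s \<bullet> (F (x s) - F (y s))))
        (at s within {0..t})"
      unfolding power2_norm_eq_inner has_field_derivative_def
      by (rule has_derivative_eq_rhs[OF has_derivative_inner[OF deriv_z deriv_z]])
        (simp add: inner_commute fun_eq_iff)
    have "?z s \<bullet> (F (x s) - F (y s)) \<le> norm (?z s) * norm (F (x s) - F (y s))"
      by (rule norm_cauchy_schwarz)
    also have "\<dots> \<le> norm (?z s) * (L * norm (?z s))"
      using lipschitz_on_normD[OF L_lipschitz] s by (intro mult_left_mono) auto
    finally show "2 * (?z s \<bullet> (F (x s) - F (y s))) \<le> 2 * L * (norm (?z s))\<^sup>2"
      by (simp add: power2_eq_square mult_ac)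
  qed
  then show ?thesis using assms(4) by simp
qed

section \<open>The polynomials of the Bach flow\<close>

definition quad :: "real \<Rightarrow> real \<Rightarrow> real" where
  "quad b c = b^2 + b*c + c^2"

lemma quad_eq_gap: "quad b c = (c - b)^2 + 3 * (b * c)"
  unfolding quad_def by algebra

lemma product_le_quad: "3 * (b * c) \<le> quad b c"
  by (simp add: quad_eq_gap)

lemma pp_eq: "pp a b c = (c - b)^2 * (quad b c - a * (b + c)) + a^2 * (b * c - a * (b + c)) + a^4"
  unfolding pp_def quad_def by algebra

lemma qq_eq:
  "qq a b c = (c - b)^2 * (a * (b + c) - 3 * quad b c)
     + a^2 * (b * c - 3 * (a * (b + c))) + 5 * a^4"
  unfolding qq_def quad_def by algebra

lemma rr_eq:
  "rr a b c = (c - b)^2 * (a * (b + c) - 4 * quad b c)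
     + a^2 * (2 * (b * c) - 5 * (a * (b + c))) + 8 * a^4"
  unfolding rr_def pp_eq qq_eq by (simp add: field_simps)

lemma pp_commute: "pp x y z = pp y x z" "pp x y z = pp x z y"
  unfolding pp_def by algebra+

lemma qq_commute: "qq x y z = qq x z y"
  unfolding qq_def by algebra

lemma pp_homogeneous: "pp (k * x) (k * y) (k * z) = k^4 * pp x y z"
  unfolding pp_def by algebra

lemma qq_homogeneous: "qq (k * x) (k * y) (k * z) = k^4 * qq x y z"
  unfolding qq_def by algebra

lemma rr_cyclic_sum: "rr a b c + rr b a c + rr c a b = 0"
  unfolding rr_eq quad_def by algebra

lemma rr_lower_bound: "- 17 * (b^2 + c^2)^2 \<le> rr a b c"
proof -
  define s d N where "s = b + c" and "d = c - b" and "N = b^2 + c^2"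
  have s_sq: "s^2 = 2 * N - d^2" and bc: "2 * (b * c) = N - d^2"
    unfolding s_def d_def N_def by algebra+
  have N: "0 \<le> N" by (simp add: N_def)
  have d_sq: "d^2 \<le> 2 * N" using zero_le_power2[of s] s_sq by linarith
  have as_sq: "(a * s)^2 \<le> 2 * (a^2 * N)"
    unfolding power_mult_distrib s_sq by (simp add: right_diff_distrib)
  have "2 * quad b c = 3 * N - d^2" unfolding quad_def N_def d_def by algebra
  then have "rr a b c = 8 * a^4 - 5 * (a^2 * (a * s)) + a^2 * N - a^2 * d^2 + d^2 * (a * s)
      - 6 * (d^2 * N) + 2 * d^4"
    unfolding rr_eq s_def[symmetric] d_def[symmetric] using bc by algebra
  moreover have "2 * (a^2 * (a * s)) \<le> a^4 + (a * s)^2"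
    using zero_le_power2[of "a^2 - a * s"] by (simp add: power2_diff)
  moreover have "- (2 * (d^2 * (a * s))) \<le> d^4 + (a * s)^2"
    using zero_le_power2[of "d^2 + a * s"] by (simp add: power2_sum)
  moreover have "a^2 * d^2 \<le> a^2 * (2 * N)" "d^2 * N \<le> 2 * N * N"
    using d_sq N by (intro mult_left_mono mult_right_mono; simp)+
  moreover have "2 * (a^2 * N) \<le> a^4 + N^2"
    using zero_le_power2[of "a^2 - N"] by (simp add: power2_diff)
  moreover have "0 \<le> a^4" "0 \<le> d^4" "0 \<le> N^2" by simp_all
  ultimately have "- 17 * N^2 \<le> rr a b c"
    using as_sq unfolding power2_eq_square[of N] by linarith
  then show ?thesis by (simp add: N_def)
qed

lemma scaled_sum_le_product:
  fixes a b c n :: "'a::linordered_idom"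
  assumes "0 \<le> a" "a \<le> 1" "0 \<le> n" "n \<le> b" "n \<le> c"
  shows "n * (a * (b + c)) \<le> 2 * (b * c)"
proof -
  have "a * (b + c) \<le> 1 * (b + c)" using assms by (intro mult_right_mono) auto
  then have "n * (a * (b + c)) \<le> n * b + n * c"
    using mult_left_mono[OF _ assms(3)] by (fastforce simp: distrib_left)
  also have "\<dots> \<le> c * b + b * c" using assms by (intro add_mono mult_right_mono) auto
  finally show ?thesis by (simp add: mult.commute)
qed

lemma rr_upper_bound:
  assumes "0 \<le> a" "a \<le> 1" "1 \<le> b" "1 \<le> c"
  shows "rr a b c \<le> a * (8 + 2 * (a * (b * c)))"
proof -
  have "a * (b + c) \<le> 2 * (b * c)" using scaled_sum_le_product[of a 1 b c] assms by simp
  also have "\<dots> \<le> 4 * quad b c"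
    using assms product_le_quad[of b c] mult_nonneg_nonneg[of b c] by linarith
  finally have "(c - b)^2 * (a * (b + c) - 4 * quad b c) \<le> 0"
    by (intro mult_nonneg_nonpos) auto
  moreover have "0 \<le> a^2 * (5 * (a * (b + c)))" using assms by simp
  moreover have "a^4 \<le> a" using power_decreasing[of 1 4 a] assms by simp
  moreover have "rr a b c = (c - b)^2 * (a * (b + c) - 4 * quad b c)
      - a^2 * (5 * (a * (b + c))) + a * (2 * (a * (b * c))) + 8 * a^4"
    unfolding rr_eq by algebra
  ultimately show ?thesis unfolding distrib_left[of a 8] by linarith
qed

definition gap_rate :: "real \<Rightarrow> real \<Rightarrow> real \<Rightarrow> real" where
  "gap_rate a b c = 8 * (b^4 + c^4) + 7 * (b * c * (b^2 + c^2)) + 6 * (b * c)^2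
     - a * (b + c) * (5 * b^2 + 2 * (b * c) + 5 * c^2) - a^2 * (b * c) + a^3 * (b + c) - 4 * a^4"

lemma gap_rate_eq: "c * rr c a b - b * rr b a c = (c - b) * gap_rate a b c"
  unfolding rr_eq quad_def gap_rate_def by algebra

context
  fixes a b c :: real
  assumes a_unit: "0 \<le> a" "a \<le> 1" and bc_ge: "12 \<le> b" "12 \<le> c"
begin

lemma six_scaled_sum_le: "6 * (a * (b + c)) \<le> b * c"
  using scaled_sum_le_product[of a 12 b c] a_unit bc_ge by simp

lemma product_ge_144: "144 \<le> b * c"
  using mult_mono[OF bc_ge] bc_ge by simp

lemma pp_lower_bound: "a^2 * (b * c) / 2 \<le> pp a b c"
proof -
  have "0 \<le> (c - b)^2 * (quad b c - a * (b + c))"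
    using six_scaled_sum_le product_ge_144 product_le_quad[of b c]
    by (intro mult_nonneg_nonneg) auto
  moreover have "a^2 * (b * c / 2) \<le> a^2 * (b * c - a * (b + c))"
    using six_scaled_sum_le product_ge_144 by (intro mult_left_mono) auto
  moreover have "0 \<le> a^4" by simp
  ultimately show ?thesis unfolding pp_eq by linarith
qed

lemma pp_upper_bound: "pp a b c \<le> quad b c ^ 2 + quad b c + 1"
proof -
  have "0 \<le> a * (b + c)" using a_unit bc_ge by simp
  then have "(c - b)^2 * (quad b c - a * (b + c)) \<le> quad b c * quad b c"
    using six_scaled_sum_le product_ge_144 quad_eq_gap[of b c] zero_le_power2[of "c - b"]
    by (intro mult_mono) linarith+
  moreover have "a^2 * (b * c - a * (b + c)) \<le> 1 * quad b c"
    using \<open>0 \<le> a * (b + c)\<close> a_unit six_scaled_sum_le product_ge_144 product_le_quad[of b c]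
    by (intro mult_mono) (auto simp: power_le_one)
  moreover have "a^4 \<le> 1" using a_unit by (simp add: power_le_one)
  ultimately show ?thesis unfolding pp_eq power2_eq_square[of "quad b c"] by linarith
qed

lemma qq_lower_bound: "a^2 * (b * c) / 2 - 3 * ((c - b)^2 * quad b c) \<le> qq a b c"
proof -
  have "0 \<le> (c - b)^2 * (a * (b + c))" using a_unit bc_ge by simp
  moreover have "a^2 * (b * c / 2) \<le> a^2 * (b * c - 3 * (a * (b + c)))"
    using six_scaled_sum_le by (intro mult_left_mono) auto
  moreover have "0 \<le> a^4" by simp
  ultimately show ?thesis unfolding qq_eq right_diff_distrib[of "(c - b)^2"] by linarith
qed

lemma gap_rate_lower_bound: "quad b c ^ 2 \<le> gap_rate a b c"
proof -
  define m n where "m = b * c * (b^2 + c^2)" and "n = b^4 + c^4"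
  have "a * (b + c) * (5 * b^2 + 2 * (b * c) + 5 * c^2) \<le> b * c / 6 * (6 * (b^2 + c^2 + b * c))"
    using a_unit bc_ge six_scaled_sum_le product_ge_144 by (intro mult_mono) auto
  also have "\<dots> = m + (b * c)^2" unfolding m_def by algebra
  finally have "8 * n + 6 * m + 5 * (b * c)^2 - a^2 * (b * c) + a^3 * (b + c) - 4 * a^4
      \<le> gap_rate a b c"
    unfolding gap_rate_def m_def[symmetric] n_def[symmetric] by linarith
  moreover have "a^2 * (b * c) \<le> 1 * (b * c)"
    using a_unit product_ge_144 by (intro mult_right_mono) (auto simp: power_le_one)
  moreover have "144 * (b * c) \<le> (b * c)^2"
    unfolding power2_eq_square using product_ge_144 by (intro mult_right_mono) auto
  moreover have "0 \<le> a^3 * (b + c)" "a^4 \<le> 1" "0 \<le> m" "0 \<le> n"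
    using a_unit bc_ge by (simp_all add: power_le_one m_def n_def)
  moreover have "quad b c ^ 2 = n + 2 * m + 3 * (b * c)^2"
    unfolding quad_def m_def n_def by algebra
  ultimately show ?thesis using product_ge_144 by linarith
qed

lemma qq_gap_rate_bound: "a^2 * (b * c) / 2 \<le> qq a b c + 4/3 * ((c - b)^2 * gap_rate a b c)"
proof -
  have "9/4 * quad b c \<le> quad b c * quad b c"
    using product_ge_144 product_le_quad[of b c] by (intro mult_right_mono) auto
  then have "quad b c \<le> 4/9 * gap_rate a b c"
    using gap_rate_lower_bound by (simp add: power2_eq_square)
  then have "(c - b)^2 * quad b c \<le> (c - b)^2 * (4/9 * gap_rate a b c)"
    by (rule mult_left_mono) simp
  then show ?thesis using qq_lower_bound by simp
qed

lemma pp_gap_rate_bound: "pp a b c / 3 + 1 \<le> 2/3 * gap_rate a b c"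
proof -
  have "6 * quad b c \<le> quad b c * quad b c"
    using product_ge_144 product_le_quad[of b c] by (intro mult_right_mono) auto
  then show ?thesis
    using pp_upper_bound gap_rate_lower_bound product_ge_144 product_le_quad[of b c]
    unfolding power2_eq_square by linarith
qed

end

section \<open>The planar system\<close>

lemma continuous_nonvanishing_pos:
  fixes f :: "real \<Rightarrow> real"
  assumes "continuous_on {a..b} f" "0 < f a" "\<And>t. t \<in> {a..b} \<Longrightarrow> f t \<noteq> 0" "t \<in> {a..b}"
  shows "0 < f t"
proof (rule ccontr)
  assume "\<not> 0 < f t"
  then have "\<exists>s\<ge>a. s \<le> t \<and> f s = 0"
    using assms by (intro IVT2') (auto intro: continuous_on_subset)
  then show False using assms(3,4) by auto
qed

lemma P_solution_subset:
  "P_solution D b0 c0 I b c \<Longrightarrow> J \<subseteq> I \<Longrightarrow> P_solution D b0 c0 J b c"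
  unfolding P_solution_def by (meson DERIV_subset subsetD)

lemma P_solution_continuous:
  assumes "P_solution D b0 c0 I b c"
  shows "continuous_on I b" "continuous_on I c"
  using assms unfolding P_solution_def by (auto intro: DERIV_continuous_on)

lemma P_solution_product:
  assumes "P_solution D b0 c0 I b c" "t \<in> I"
  shows "((\<lambda>t. b t * c t) has_real_derivative
           2/3 * rr (D / (b t * c t)) (b t) (c t) * (b t * c t)) (at t within I)"
proof -
  let ?a = "D / (b t * c t)"
  have "- (2/3) * rr (b t) ?a (c t) * b t * c t + - (2/3) * rr (c t) ?a (b t) * c t * b t
      = 2/3 * rr ?a (b t) (c t) * (b t * c t)"
    using rr_cyclic_sum[of ?a "b t" "c t"] by algebra
  then show ?thesis
    using assms unfolding P_solution_def by (auto intro: DERIV_cong[OF DERIV_mult])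
qed

text \<open>At a zero of \<open>b c\<close> the quotient \<open>D / (b c)\<close> takes the junk value 0. This does no harm,
  since \<open>rr_lower_bound\<close> holds for every value of the first argument.\<close>

lemma P_solution_product_nonzero:
  assumes solution: "P_solution D b0 c0 {0..t} b c" and "0 < b0" "0 < c0" "0 \<le> t"
  shows "b t * c t \<noteq> 0"
proof -
  let ?u = "\<lambda>s. b s * c s"
  have "continuous_on {0..t} (\<lambda>s. ((b s)^2 + (c s)^2)^2)"
    by (intro continuous_intros P_solution_continuous[OF solution])
  then obtain r where sup: "\<And>s. s \<in> {0..t} \<Longrightarrow> ((b s)^2 + (c s)^2)^2 \<le> ((b r)^2 + (c r)^2)^2"
    using continuous_attains_sup[of "{0..t}"] assms(4) by fastforce
  define M where "M = ((b r)^2 + (c r)^2)^2"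
  have "- ((?u t)^2) \<le> - ((?u 0)^2) * exp (- (68/3 * M) * (t - 0))"
  proof (rule gronwall_inequality[OF assms(4)])
    fix s assume s: "s \<in> {0..t}"
    let ?r = "rr (D / ?u s) (b s) (c s)"
    show "((\<lambda>s. - ((?u s)^2)) has_real_derivative - 4/3 * ?r * (?u s)^2) (at s within {0..t})"
      by (rule DERIV_cong[OF DERIV_minus[OF DERIV_power[OF P_solution_product[OF solution s]]]])
        (simp add: power2_eq_square)
    have "- 17 * M \<le> ?r"
      using rr_lower_bound[of "b s" "c s" "D / ?u s"] sup[OF s]
      unfolding M_def by linarith
    then have "- 4/3 * ?r \<le> 68/3 * M" by linarith
    then have "- 4/3 * ?r * (?u s)^2 \<le> 68/3 * M * (?u s)^2"
      by (rule mult_right_mono) simp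
    then show "- 4/3 * ?r * (?u s)^2 \<le> - (68/3 * M) * - ((?u s)^2)"
      unfolding minus_mult_minus .
  qed
  moreover have "0 < (?u 0)^2 * exp (- (68/3 * M) * (t - 0))"
    using solution assms(2,3) by (simp add: P_solution_def)
  ultimately show ?thesis by auto
qed

lemma P_solution_pos:
  assumes solution: "P_solution D b0 c0 {0..t} b c" and "0 < b0" "0 < c0" "0 \<le> t"
  shows "0 < b t" "0 < c t"
proof -
  have "b s * c s \<noteq> 0" if "s \<in> {0..t}" for s
    using P_solution_product_nonzero[OF P_solution_subset[OF solution]] assms(2,3) that by auto
  then have nonzero: "b s \<noteq> 0" "c s \<noteq> 0" if "s \<in> {0..t}" for s
    using that by auto
  have "0 < b 0" "0 < c 0" using solution assms(2,3) by (auto simp: P_solution_def)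
  then show "0 < b t" "0 < c t"
    using continuous_nonvanishing_pos[OF P_solution_continuous(1)[OF solution]]
      continuous_nonvanishing_pos[OF P_solution_continuous(2)[OF solution]] nonzero assms(4) by auto
qed

lemma P_solution_product_growth:
  assumes solution: "P_solution D b0 c0 {s..t} b c" and "0 < D" "s \<le> t"
    and large: "\<And>w. w \<in> {s..t} \<Longrightarrow> max 1 D \<le> b w \<and> max 1 D \<le> c w"
  shows "b t * c t \<le> b s * c s * exp (2/3 * (8 + 2 * D) * (t - s))"
proof (rule gronwall_inequality[OF assms(3) P_solution_product[OF solution]])
  fix w assume w: "w \<in> {s..t}"
  define u a where "u = b w * c w" and "a = D / u"
  have bc_ge: "1 \<le> b w" "1 \<le> c w" "D \<le> c w" using large[OF w] by auto
  then have "1 * D \<le> u" using assms(2) unfolding u_def by (intro mult_mono) auto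
  then have a_unit: "0 \<le> a" "a \<le> 1" "a * u = D" using assms(2) by (auto simp: a_def)
  have "rr a (b w) (c w) \<le> a * (8 + 2 * D)"
    using rr_upper_bound[OF a_unit(1,2) bc_ge(1,2)] a_unit(3) by (simp add: u_def)
  also have "\<dots> \<le> 8 + 2 * D" using a_unit assms(2) by simp
  finally have "2/3 * rr a (b w) (c w) * u \<le> 2/3 * (8 + 2 * D) * u"
    using bc_ge by (intro mult_right_mono) (auto simp: u_def)
  then show "2/3 * rr (D / (b w * c w)) (b w) (c w) * (b w * c w) \<le> 2/3 * (8 + 2 * D) * (b w * c w)"
    by (simp add: a_def u_def)
qed

lemma P_solution_no_finite_time_escape:
  assumes solution: "P_solution D b0 c0 {0..<T} b c" and "0 < D" "0 < T"
    and lim: "filterlim b at_top (at_left T)" "filterlim c at_top (at_left T)"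
  shows False
proof -
  let ?K = "2/3 * (8 + 2 * D)"
  have "\<forall>\<^sub>F t in at_left T. max 1 D \<le> b t \<and> max 1 D \<le> c t"
    using lim unfolding filterlim_at_top by (intro eventually_conj) blast+
  then obtain r where "r < T" and large: "\<And>t. r < t \<Longrightarrow> t < T \<Longrightarrow> max 1 D \<le> b t \<and> max 1 D \<le> c t"
    unfolding eventually_at_left_field by blast
  define s where "s = (max r 0 + T) / 2"
  have s: "r < s" "0 < s" "s < T" using \<open>r < T\<close> assms(3) by (auto simp: s_def)
  define B where "B = b s * c s * exp (?K * (T - s))"
  have "b t \<le> B" if t: "s < t" "t < T" for t
  proof -
    have ge_1: "1 \<le> b s" "1 \<le> c s" "1 \<le> b t" "1 \<le> c t" using large[of s] large[of t] s t by auto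
    have "b t * 1 \<le> b t * c t" using ge_1 by (intro mult_left_mono) auto
    also have "\<dots> \<le> b s * c s * exp (?K * (t - s))"
    proof (rule P_solution_product_growth[OF P_solution_subset[OF solution] assms(2)])
      show "max 1 D \<le> b w \<and> max 1 D \<le> c w" if "w \<in> {s..t}" for w
        using that s t by (intro large) auto
    qed (use s t in auto)
    also have "\<dots> \<le> B"
      unfolding B_def using t assms(2) ge_1
      by (intro mult_left_mono) auto
    finally show ?thesis by simp
  qed
  then have "\<forall>\<^sub>F t in at_left T. b t \<le> B"
    unfolding eventually_at_left_field using s(3) by blast
  moreover have "\<forall>\<^sub>F t in at_left T. B < b t"
    using lim(1) by (simp add: filterlim_at_top_dense)
  ultimately have "\<forall>\<^sub>F t in at_left T. False"
    by eventually_elim simp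
  then show False by (simp add: trivial_limit_at_left_real)
qed

section \<open>Escaping trajectories\<close>

locale escaping_P_solution =
  fixes D b0 c0 k0 :: real and b c :: "real \<Rightarrow> real"
  assumes D_pos: "0 < D" and init_pos: "0 < b0" "0 < c0" "0 < k0"
    and solution: "P_solution D b0 c0 {0..} b c"
    and b_lim: "filterlim b at_top at_top" and c_lim: "filterlim c at_top at_top"
begin

definition a :: "real \<Rightarrow> real" where
  "a s = D / (b s * c s)"

abbreviation p :: "real \<Rightarrow> real" where
  "p s \<equiv> pp (a s) (b s) (c s)"

abbreviation q :: "real \<Rightarrow> real" where
  "q s \<equiv> qq (a s) (b s) (c s)"

abbreviation r :: "real \<Rightarrow> real" where
  "r s \<equiv> rr (a s) (b s) (c s)"

abbreviation W :: "real \<Rightarrow> real" where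
  "W s \<equiv> gap_rate (a s) (b s) (c s)"

text \<open>The value of $g_{00}^{1/3}$ in the time of (P).\<close>

definition k :: "real \<Rightarrow> real" where
  "k s = k0 * exp (- integral {0..s} p / 3)"

lemma bc_pos: assumes "0 \<le> s" shows "0 < b s" "0 < c s"
  using P_solution_pos[OF P_solution_subset[OF solution]] init_pos assms by auto

lemma a_pos: "0 \<le> s \<Longrightarrow> 0 < a s"
  using bc_pos D_pos by (simp add: a_def)

lemma a_times_bc: "0 \<le> s \<Longrightarrow> a s * (b s * c s) = D"
  using bc_pos[of s] by (simp add: a_def)

lemma k_pos: "0 < k s"
  using init_pos by (simp add: k_def)

lemma deriv_b: "0 \<le> s \<Longrightarrow>
    (b has_real_derivative - (2/3) * rr (b s) (a s) (c s) * b s) (at s within {0..})"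
  and deriv_c: "0 \<le> s \<Longrightarrow>
    (c has_real_derivative - (2/3) * rr (c s) (a s) (b s) * c s) (at s within {0..})"
  using solution by (auto simp: P_solution_def a_def)

lemma deriv_bc: "0 \<le> s \<Longrightarrow>
    ((\<lambda>s. b s * c s) has_real_derivative 2/3 * r s * (b s * c s)) (at s within {0..})"
  using P_solution_product[OF solution, of s] by (simp add: a_def)

lemma deriv_a:
  assumes "0 \<le> s"
  shows "(a has_real_derivative - (2/3) * r s * a s) (at s within {0..})"
proof -
  have "((\<lambda>s. D / (b s * c s)) has_real_derivative - (2/3) * r s * a s) (at s within {0..})"
    by (rule DERIV_cong[OF DERIV_divide[OF DERIV_const deriv_bc[OF assms]]])
      (use bc_pos[OF assms] in \<open>simp_all add: a_def\<close>)
  then show ?thesis by (simp only: a_def[abs_def])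
qed

lemma deriv_gap:
  assumes "0 \<le> s"
  shows "((\<lambda>s. c s - b s) has_real_derivative
     - (2/3) * W s * (c s - b s)) (at s within {0..})"
  by (rule DERIV_cong[OF DERIV_diff[OF deriv_c[OF assms] deriv_b[OF assms]]])
    (use gap_rate_eq[of "c s" "a s" "b s"] in algebra)

lemma continuous_p: "continuous_on {0..} p"
proof -
  have "continuous_on {0..} a" by (rule DERIV_continuous_on[OF deriv_a]) simp
  then show ?thesis
    unfolding pp_def by (intro continuous_intros P_solution_continuous[OF solution])
qed

lemma deriv_integral_p: "0 \<le> s \<Longrightarrow>
    ((\<lambda>s. integral {0..s} p) has_real_derivative p s) (at s within {0..})"
  using integral_has_real_derivative_atLeast[OF continuous_p] by simp

lemma deriv_k:
  assumes "0 \<le> s"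
  shows "(k has_real_derivative - (p s / 3) * k s) (at s within {0..})"
  unfolding k_def[abs_def] by (rule derivative_eq_intros deriv_integral_p assms | simp)+

lemma bc_lim: "filterlim (\<lambda>s. b s * c s) at_top at_top"
  by (rule filterlim_at_top_mult_at_top[OF b_lim c_lim])

lemma a_sq_bc: "0 \<le> s \<Longrightarrow> (a s)^2 * (b s * c s) = a s * D"
  using a_times_bc[of s] by (simp add: power2_eq_square)

lemma eventually_tail:
  "\<forall>\<^sub>F s in at_top. 0 < s \<and> 0 < a s \<and> a s \<le> 1 \<and> 12 \<le> b s \<and> 12 \<le> c s"
proof -
  have "((\<lambda>s. D / (b s * c s)) \<longlongrightarrow> 0) at_top"
    by (rule real_tendsto_divide_at_top[OF tendsto_const bc_lim])
  then have "\<forall>\<^sub>F s in at_top. a s < 1"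
    unfolding a_def by (rule order_tendstoD) simp
  moreover have "\<forall>\<^sub>F s in at_top. 12 \<le> b s" "\<forall>\<^sub>F s in at_top. 12 \<le> c s"
    using b_lim c_lim by (simp_all add: filterlim_at_top)
  ultimately show ?thesis
    using eventually_gt_at_top[of 0] by eventually_elim (auto simp: a_pos)
qed

text \<open>The integral of \<open>a\<close> diverges, since \<open>ln (b c)\<close> tends to infinity and its derivative is at
  most a multiple of \<open>a\<close>.\<close>

lemma filterlim_at_top_if_deriv_ge_a:
  assumes deriv: "\<And>s. 0 \<le> s \<Longrightarrow> (f has_real_derivative f' s) (at s within {0..})"
    and ge: "\<forall>\<^sub>F s in at_top. a s * D / 2 \<le> f' s"
  shows "filterlim f at_top at_top"
proof (rule filterlim_at_top_deriv_mono)
  define \<kappa> where "\<kappa> = 3/4 * D / (8 + 2 * D)"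
  have "0 < \<kappa>" using D_pos by (simp add: \<kappa>_def)
  show "filterlim (\<lambda>s. \<kappa> * ln (b s * c s)) at_top at_top"
    by (intro filterlim_tendsto_pos_mult_at_top[OF tendsto_const \<open>0 < \<kappa>\<close>]
        filterlim_compose[OF ln_at_top bc_lim])
  have "((\<lambda>s. \<kappa> * ln (b s * c s)) has_real_derivative \<kappa> * (2/3 * r s))
      (at s within {0..})" if "0 \<le> s" for s
    by (rule DERIV_cong[OF DERIV_cmult[OF
          DERIV_ln_divide[THEN DERIV_chain2, OF _ deriv_bc[OF that]]]])
      (use bc_pos[OF that] in simp_all)
  then show "\<forall>\<^sub>F s in at_top. ((\<lambda>s. \<kappa> * ln (b s * c s)) has_real_derivative
      \<kappa> * (2/3 * r s)) (at s)"
    by (rule eventually_has_real_derivative_at)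
  show "\<forall>\<^sub>F s in at_top. (f has_real_derivative f' s) (at s)"
    using deriv by (rule eventually_has_real_derivative_at)
  show "\<forall>\<^sub>F s in at_top. \<kappa> * (2/3 * r s) \<le> f' s"
    using eventually_tail ge
  proof eventually_elim
    case (elim s)
    have "r s \<le> a s * (8 + 2 * D)"
      using rr_upper_bound[of "a s" "b s" "c s"] elim by (simp add: a_times_bc)
    then have "\<kappa> * (2/3 * r s) \<le> \<kappa> * (2/3 * (a s * (8 + 2 * D)))"
      using \<open>0 < \<kappa>\<close> by (intro mult_left_mono) auto
    also have "\<dots> = a s * D / 2"
      using D_pos by (simp add: \<kappa>_def field_simps)
    finally show ?case using elim by simp
  qed
qed

lemma integral_p_lim: "filterlim (\<lambda>s. integral {0..s} p) at_top at_top"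
proof (rule filterlim_at_top_if_deriv_ge_a[OF deriv_integral_p])
  show "\<forall>\<^sub>F s in at_top. a s * D / 2 \<le> p s"
    using eventually_tail
  proof eventually_elim
    case (elim s)
    then show ?case using pp_lower_bound[of "a s" "b s" "c s"] by (simp add: a_sq_bc)
  qed
qed

lemma k_lim: "(k \<longlongrightarrow> 0) at_top"
proof -
  have "filterlim (\<lambda>s. - integral {0..s} p / 3) at_bot at_top"
    using filterlim_tendsto_pos_mult_at_top[OF tendsto_const[of "1/3"] _ integral_p_lim]
    by (simp add: filterlim_uminus_at_top)
  then show ?thesis
    unfolding k_def[abs_def] by (intro tendsto_mult_right_zero filterlim_compose[OF exp_at_bot])
qed

lemma deriv_div_k:
  assumes "0 \<le> s" "(f has_real_derivative - (2/3) * l * f s) (at s within {0..})"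
  shows "((\<lambda>s. f s / k s) has_real_derivative (p s / 3 - 2/3 * l) * (f s / k s))
    (at s within {0..})"
  by (rule DERIV_cong[OF DERIV_divide[OF assms(2) deriv_k[OF assms(1)]]])
    (use k_pos[of s] in \<open>simp_all add: field_simps\<close>)

lemma deriv_a_div_k:
  assumes "0 \<le> s"
  shows "((\<lambda>s. a s / k s) has_real_derivative - q s * (a s / k s)) (at s within {0..})"
  by (rule DERIV_cong[OF deriv_div_k[OF assms deriv_a[OF assms]]])
    (simp add: rr_def field_simps)

lemma deriv_b_div_k:
  assumes "0 \<le> s"
  shows "((\<lambda>s. b s / k s) has_real_derivative - qq (b s) (a s) (c s) * (b s / k s))
    (at s within {0..})"
  by (rule DERIV_cong[OF deriv_div_k[OF assms deriv_b[OF assms]]])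
    (simp add: rr_def pp_commute(1)[of "b s"] field_simps)

lemma deriv_c_div_k:
  assumes "0 \<le> s"
  shows "((\<lambda>s. c s / k s) has_real_derivative - qq (c s) (a s) (b s) * (c s / k s))
    (at s within {0..})"
  by (rule DERIV_cong[OF deriv_div_k[OF assms deriv_c[OF assms]]])
    (simp add: rr_def pp_commute(1)[of "c s"] pp_commute(2)[of "a s" "c s"] field_simps)

lemma gap_div_k_lim: "((\<lambda>s. (c s - b s) / k s) \<longlongrightarrow> 0) at_top"
proof -
  let ?y = "\<lambda>s. (c s - b s) / k s"
  let ?rate = "\<lambda>s. p s / 3 - 2/3 * W s"
  have "\<forall>\<^sub>F s in at_top. ((\<lambda>s. (?y s)^2) has_real_derivative 2 * ?rate s * (?y s)^2) (at s)"
  proof (rule eventually_has_real_derivative_at)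
    fix s :: real assume "0 \<le> s"
    show "((\<lambda>s. (?y s)^2) has_real_derivative 2 * ?rate s * (?y s)^2) (at s within {0..})"
      by (rule DERIV_cong[OF DERIV_power[OF deriv_div_k[OF \<open>0 \<le> s\<close> deriv_gap[OF \<open>0 \<le> s\<close>]], of 2]])
        (simp add: power2_eq_square)
  qed
  moreover have "\<forall>\<^sub>F s in at_top. 2 * ?rate s * (?y s)^2 \<le> - 2 * (?y s)^2"
    using eventually_tail
  proof eventually_elim
    case (elim s)
    have "?rate s \<le> - 1" using pp_gap_rate_bound[of "a s" "b s" "c s"] elim by simp
    then show ?case by (intro mult_right_mono) auto
  qed
  ultimately obtain C where bound: "\<forall>\<^sub>F s in at_top. (?y s)^2 \<le> C * exp (- 2 * s)"
    by (rule eventually_gronwall)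
  have "filterlim (\<lambda>s::real. - 2 * s) at_bot at_top"
    by (rule filterlim_tendsto_neg_mult_at_bot[OF tendsto_const _ filterlim_ident]) simp
  then have bound_lim: "((\<lambda>s. C * exp (- 2 * s)) \<longlongrightarrow> 0) at_top"
    by (intro tendsto_mult_right_zero filterlim_compose[OF exp_at_bot])
  have "((\<lambda>s. (?y s)^2) \<longlongrightarrow> 0) at_top"
    by (rule tendsto_sandwich[OF _ bound tendsto_const bound_lim]) simp
  then show ?thesis by simp
qed

lemma a_div_k_lim: "((\<lambda>s. a s / k s) \<longlongrightarrow> 0) at_top"
proof -
  let ?v = "\<lambda>s. - ln (a s / k s) - (c s - b s)^2"
  have "filterlim ?v at_top at_top"
  proof (rule filterlim_at_top_if_deriv_ge_a)
    fix s :: real assume s: "0 \<le> s"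
    have deriv_ln: "((\<lambda>s. ln (a s / k s)) has_real_derivative - q s) (at s within {0..})"
      by (rule DERIV_cong[OF DERIV_ln_divide[THEN DERIV_chain2, OF _ deriv_a_div_k[OF s]]])
        (use a_pos[OF s] k_pos[of s] in simp_all)
    show "(?v has_real_derivative q s + 4/3 * ((c s - b s)^2 * W s)) (at s within {0..})"
      by (rule DERIV_cong[OF DERIV_diff[OF DERIV_minus[OF deriv_ln]
            DERIV_power[OF deriv_gap[OF s], of 2]]])
        (simp add: power2_eq_square)
  next
    show "\<forall>\<^sub>F s in at_top. a s * D / 2 \<le> q s + 4/3 * ((c s - b s)^2 * W s)"
      using eventually_tail
    proof eventually_elim
      case (elim s)
      then show ?case using qq_gap_rate_bound[of "a s" "b s" "c s"] by (simp add: a_sq_bc)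
    qed
  qed
  then have "filterlim (\<lambda>s. - ln (a s / k s)) at_top at_top"
    by (rule filterlim_at_top_mono) simp
  then have "((\<lambda>s. exp (ln (a s / k s))) \<longlongrightarrow> 0) at_top"
    by (intro filterlim_compose[OF exp_at_bot]) (simp add: filterlim_uminus_at_top)
  moreover have "\<forall>\<^sub>F s in at_top. exp (ln (a s / k s)) = a s / k s"
    using eventually_ge_at_top[of 0] by eventually_elim (use a_pos k_pos in simp)
  ultimately show ?thesis by (rule Lim_transform_eventually)
qed

lemma b_div_k_lim: "filterlim (\<lambda>s. b s / k s) at_top at_top"
proof (rule filterlim_at_top_mono[OF b_lim])
  have "\<forall>\<^sub>F s in at_top. k s < 1"
    using k_lim by (rule order_tendstoD) simp
  then show "\<forall>\<^sub>F s in at_top. b s \<le> b s / k s"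
    using eventually_ge_at_top[of 0]
  proof eventually_elim
    case (elim s)
    then show ?case using bc_pos(1)[of s] k_pos[of s] by (simp add: field_simps)
  qed
qed

lemma c_div_k_lim: "filterlim (\<lambda>s. c s / k s) at_top at_top"
  using filterlim_tendsto_add_at_top[OF gap_div_k_lim b_div_k_lim]
  by (simp flip: add_divide_distrib)

end

section \<open>The system (S3)\<close>

type_synonym diagonal_metric = "real \<times> real \<times> real \<times> real"

definition S3_field :: "real \<Rightarrow> diagonal_metric \<Rightarrow> diagonal_metric" where
  "S3_field \<beta> = (\<lambda>(x0, x1, x2, x3).
     (- \<beta> * pp x1 x2 x3 * x0^3, - \<beta> * qq x1 x2 x3 * x0^2 * x1,
      - \<beta> * qq x2 x3 x1 * x0^2 * x2, - \<beta> * qq x3 x1 x2 * x0^2 * x3))"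

lemma has_vector_derivative_Pair_iff:
  "((\<lambda>t. (f t, g t)) has_vector_derivative (f', g')) (at t within S) \<longleftrightarrow>
     (f has_vector_derivative f') (at t within S) \<and> (g has_vector_derivative g') (at t within S)"
  using bounded_linear.has_vector_derivative[OF bounded_linear_fst, of "\<lambda>t. (f t, g t)" "(f', g')"]
    bounded_linear.has_vector_derivative[OF bounded_linear_snd, of "\<lambda>t. (f t, g t)" "(f', g')"]
  by (auto intro: has_vector_derivative_Pair)

lemma S3_solution_iff_field:
  "S3_solution h0 h1 h2 h3 I g0 g1 g2 g3 \<longleftrightarrow>
     (g0 0, g1 0, g2 0, g3 0) = (h0, h1, h2, h3) \<and>
     (\<forall>t\<in>I. ((\<lambda>t. (g0 t, g1 t, g2 t, g3 t)) has_vector_derivative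
        S3_field (bach_beta (h0 * h1 * h2 * h3)) (g0 t, g1 t, g2 t, g3 t)) (at t within I))"
  by (simp add: S3_solution_def Let_def S3_field_def has_vector_derivative_Pair_iff
      has_real_derivative_iff_has_vector_derivative)

lemma S3_field_lipschitz_on:
  assumes "bounded S"
  shows "\<exists>L. L-lipschitz_on S (S3_field \<beta>)"
proof -
  let ?x0 = "\<lambda>x::diagonal_metric. fst x" and ?x1 = "\<lambda>x::diagonal_metric. fst (snd x)"
    and ?x2 = "\<lambda>x::diagonal_metric. fst (snd (snd x))"
    and ?x3 = "\<lambda>x::diagonal_metric. snd (snd (snd x))"
  have coord: "real_polynomial_function ?x0" "real_polynomial_function ?x1"
    "real_polynomial_function ?x2" "real_polynomial_function ?x3"
    by (intro real_polynomial_function.intros(1) bounded_linear_intros)+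
  have poly: "real_polynomial_function (\<lambda>x. pp (?x1 x) (?x2 x) (?x3 x))"
    "real_polynomial_function (\<lambda>x. qq (?x1 x) (?x2 x) (?x3 x))"
    "real_polynomial_function (\<lambda>x. qq (?x2 x) (?x3 x) (?x1 x))"
    "real_polynomial_function (\<lambda>x. qq (?x3 x) (?x1 x) (?x2 x))"
    unfolding pp_def qq_def
    by (intro real_polynomial_function.intros(2-) real_polynomial_function_diff
        real_polynomial_function_minus real_polynomial_function_power coord)+
  let ?f0 = "\<lambda>x. - \<beta> * pp (?x1 x) (?x2 x) (?x3 x) * ?x0 x ^ 3"
    and ?f1 = "\<lambda>x. - \<beta> * qq (?x1 x) (?x2 x) (?x3 x) * ?x0 x ^ 2 * ?x1 x"
    and ?f2 = "\<lambda>x. - \<beta> * qq (?x2 x) (?x3 x) (?x1 x) * ?x0 x ^ 2 * ?x2 x"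
    and ?f3 = "\<lambda>x. - \<beta> * qq (?x3 x) (?x1 x) (?x2 x) * ?x0 x ^ 2 * ?x3 x"
  have "real_polynomial_function ?f0" "real_polynomial_function ?f1"
    "real_polynomial_function ?f2" "real_polynomial_function ?f3"
    by (intro real_polynomial_function.intros(2-) real_polynomial_function_power coord poly)+
  note this[THEN real_polynomial_function_lipschitz_on, OF assms]
  then obtain L0 L1 L2 L3 where components: "L0-lipschitz_on S ?f0" "L1-lipschitz_on S ?f1"
    "L2-lipschitz_on S ?f2" "L3-lipschitz_on S ?f3"
    by blast
  note lipschitz_on_Pair[OF components(1) lipschitz_on_Pair[OF components(2)
        lipschitz_on_Pair[OF components(3,4)]]]
  then show ?thesis
    unfolding S3_field_def case_prod_beta by blast
qed

lemma S3_solution_unique: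
  assumes "S3_solution h0 h1 h2 h3 {0..} g0 g1 g2 g3"
    and "S3_solution h0 h1 h2 h3 {0..} g0' g1' g2' g3'"
    and "0 \<le> t"
  shows "(g0 t, g1 t, g2 t, g3 t) = (g0' t, g1' t, g2' t, g3' t)"
  by (rule ode_unique[OF S3_field_lipschitz_on[of _ "bach_beta (h0 * h1 * h2 * h3)"] _ _ _
        assms(3)])
    (use assms(1,2) in \<open>auto simp: S3_solution_iff_field\<close>)

definition collapses :: "(real \<Rightarrow> real) \<Rightarrow> (real \<Rightarrow> real) \<Rightarrow> (real \<Rightarrow> real) \<Rightarrow> (real \<Rightarrow> real) \<Rightarrow> bool" where
  "collapses g0 g1 g2 g3 \<longleftrightarrow>
     (g0 \<longlongrightarrow> 0) at_top \<and> (g1 \<longlongrightarrow> 0) at_top \<and>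
     filterlim g2 at_top at_top \<and> filterlim g3 at_top at_top \<and>
     ((\<lambda>t. g3 t - g2 t) \<longlongrightarrow> 0) at_top"

lemma collapses_cong:
  assumes "\<And>t. 0 \<le> t \<Longrightarrow> (g0 t, g1 t, g2 t, g3 t) = (g0' t, g1' t, g2' t, g3' t)"
    and "collapses g0 g1 g2 g3"
  shows "collapses g0' g1' g2' g3'"
proof -
  have "\<forall>\<^sub>F t in at_top. g0 t = g0' t" "\<forall>\<^sub>F t in at_top. g1 t = g1' t"
    "\<forall>\<^sub>F t in at_top. g2 t = g2' t" "\<forall>\<^sub>F t in at_top. g3 t = g3' t"
    "\<forall>\<^sub>F t in at_top. g3 t - g2 t = g3' t - g2' t"
    using assms(1) by (auto intro!: eventually_at_top_linorderI[of 0])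
  note this[THEN filterlim_cong[OF refl refl]]
  with assms(2) show ?thesis by (simp add: collapses_def)
qed

lemma S3_field_rescaled:
  assumes "k \<noteq> 0"
  shows "S3_field \<beta> (k^3, a / k, b / k, c / k) = (\<beta> * k^2) *\<^sub>R
    (- pp a b c * k^3, - qq a b c * (a / k), - qq b a c * (b / k), - qq c a b * (c / k))"
proof -
  have "pp a b c = k^4 * pp (a / k) (b / k) (c / k)" "qq a b c = k^4 * qq (a / k) (b / k) (c / k)"
    "qq b a c = k^4 * qq (b / k) (c / k) (a / k)" "qq c a b = k^4 * qq (c / k) (a / k) (b / k)"
    using assms by (simp_all add: qq_commute[of b a] flip: pp_homogeneous qq_homogeneous)
  then show ?thesis by (simp only: S3_field_def) (simp add: power_numeral_reduce)
qed

context escaping_P_solution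
begin

abbreviation rescaled_metric :: "real \<Rightarrow> diagonal_metric" where
  "rescaled_metric s \<equiv> (k s^3, a s / k s, b s / k s, c s / k s)"

abbreviation S3_solution_from_init ::
  "(real \<Rightarrow> real) \<Rightarrow> (real \<Rightarrow> real) \<Rightarrow> (real \<Rightarrow> real) \<Rightarrow> (real \<Rightarrow> real) \<Rightarrow> bool" where
  "S3_solution_from_init \<equiv> S3_solution (k0^3) (D / (b0 * c0) / k0) (b0 / k0) (c0 / k0) {0..}"

lemma deriv_rescaled_metric:
  assumes "0 \<le> s" "0 < \<beta>"
  shows "(rescaled_metric has_vector_derivative
    (1 / (\<beta> * k s^2)) *\<^sub>R S3_field \<beta> (rescaled_metric s)) (at s within {0..})"
proof -
  have "((\<lambda>s. k s^3) has_real_derivative - p s * k s^3) (at s within {0..})"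
    by (rule DERIV_cong[OF DERIV_power[OF deriv_k[OF assms(1)], of 3]])
      (simp add: power_numeral_reduce)
  then show ?thesis
    using deriv_a_div_k deriv_b_div_k deriv_c_div_k k_pos[of s] assms
    by (simp add: S3_field_rescaled has_vector_derivative_Pair_iff
        has_real_derivative_iff_has_vector_derivative)
qed

lemma S3_solution_reparametrized:
  obtains \<sigma> where "filterlim \<sigma> at_top at_top"
    "S3_solution_from_init (\<lambda>t. k (\<sigma> t)^3) (\<lambda>t. a (\<sigma> t) / k (\<sigma> t))
       (\<lambda>t. b (\<sigma> t) / k (\<sigma> t)) (\<lambda>t. c (\<sigma> t) / k (\<sigma> t))"
proof -
  let ?\<beta> = "bach_beta D"
  have "continuous_on {0..} k" by (rule DERIV_continuous_on[OF deriv_k]) simp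
  then obtain B where k_le: "0 < B" "\<And>s. 0 \<le> s \<Longrightarrow> \<bar>k s\<bar> \<le> B"
    using bounded_atLeast_if_tendsto[OF _ k_lim, of 0] by (force simp: bounded_pos)
  have \<beta>: "0 < ?\<beta>" using D_pos by (simp add: bach_beta_def)
  have k_nonzero: "k s \<noteq> 0" for s using k_pos[of s] by simp
  have "continuous_on {0..} (\<lambda>s. 1 / (?\<beta> * k s^2))"
    using \<beta> k_nonzero \<open>continuous_on {0..} k\<close> by (intro continuous_intros) auto
  moreover have "0 < 1 / (?\<beta> * B^2)" using \<beta> k_le(1) by simp
  moreover have "1 / (?\<beta> * B^2) \<le> 1 / (?\<beta> * k s^2)" if "0 \<le> s" for s
    using \<beta> k_pos[of s] k_le(1) k_le(2)[OF that]
    by (intro divide_left_mono mult_left_mono power_mono) auto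
  ultimately obtain \<sigma> where \<sigma>: "\<sigma> 0 = 0" "filterlim \<sigma> at_top at_top"
    "\<And>t. 0 \<le> t \<Longrightarrow> ((\<lambda>t. rescaled_metric (\<sigma> t)) has_vector_derivative
       S3_field ?\<beta> (rescaled_metric (\<sigma> t))) (at t within {0..})"
    using ode_time_change[OF _ _ _ deriv_rescaled_metric[OF _ \<beta>]] by blast
  have "b 0 = b0" "c 0 = c0" "k 0 = k0" using solution by (simp_all add: P_solution_def k_def)
  moreover have "k0^3 * (D / (b0 * c0) / k0) * (b0 / k0) * (c0 / k0) = D"
    using init_pos by (simp add: power3_eq_cube)
  ultimately show thesis
    using \<sigma> by (intro that[of \<sigma>]) (simp_all add: S3_solution_iff_field a_def)
qed

lemma collapsing_S3_solution:
  "\<exists>g0 g1 g2 g3. S3_solution_from_init g0 g1 g2 g3 \<and> collapses g0 g1 g2 g3"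
proof -
  obtain \<sigma> where \<sigma>: "filterlim \<sigma> at_top at_top"
    and sol: "S3_solution_from_init (\<lambda>t. k (\<sigma> t)^3) (\<lambda>t. a (\<sigma> t) / k (\<sigma> t))
       (\<lambda>t. b (\<sigma> t) / k (\<sigma> t)) (\<lambda>t. c (\<sigma> t) / k (\<sigma> t))"
    by (rule S3_solution_reparametrized)
  have "((\<lambda>s. k s^3) \<longlongrightarrow> 0) at_top"
    using tendsto_power[OF k_lim, of 3] by simp
  note lims = this a_div_k_lim b_div_k_lim c_div_k_lim gap_div_k_lim
  have "collapses (\<lambda>t. k (\<sigma> t)^3) (\<lambda>t. a (\<sigma> t) / k (\<sigma> t)) (\<lambda>t. b (\<sigma> t) / k (\<sigma> t))
      (\<lambda>t. c (\<sigma> t) / k (\<sigma> t))"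
    unfolding collapses_def diff_divide_distrib[symmetric]
    by (intro conjI lims[THEN filterlim_compose, OF \<sigma>])
  with sol show ?thesis by blast
qed

end

lemma D_infty_escaping:
  assumes "0 < h0" "0 < h1" "0 < h2" "0 < h3" "D_infty h0 h1 h2 h3"
  obtains b c where
    "escaping_P_solution (h0 * h1 * h2 * h3) (root 3 h0 * h2) (root 3 h0 * h3) (root 3 h0) b c"
proof -
  have "0 < h0 * h1 * h2 * h3" using assms by simp
  then obtain b c where "P_solution (h0 * h1 * h2 * h3) (root 3 h0 * h2) (root 3 h0 * h3) {0..} b c"
    "filterlim b at_top at_top" "filterlim c at_top at_top"
    using assms(5) P_solution_no_finite_time_escape unfolding D_infty_def Let_def by blast
  then show thesis
    using assms by (intro that[of b c]) (unfold_locales, auto)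
qed

lemma D_infty_collapsing_S3_solution:
  assumes h_pos: "0 < h0" "0 < h1" "0 < h2" "0 < h3" and "D_infty h0 h1 h2 h3"
  obtains g0 g1 g2 g3 where "S3_solution h0 h1 h2 h3 {0..} g0 g1 g2 g3" "collapses g0 g1 g2 g3"
proof -
  let ?k0 = "root 3 h0"
  obtain b c where "escaping_P_solution (h0 * h1 * h2 * h3) (?k0 * h2) (?k0 * h3) ?k0 b c"
    using D_infty_escaping assms by blast
  then have "\<exists>g0 g1 g2 g3. S3_solution (?k0^3) (h0 * h1 * h2 * h3 / (?k0 * h2 * (?k0 * h3)) / ?k0)
      (?k0 * h2 / ?k0) (?k0 * h3 / ?k0) {0..} g0 g1 g2 g3 \<and> collapses g0 g1 g2 g3"
    by (rule escaping_P_solution.collapsing_S3_solution)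
  moreover have k0_cubed: "?k0^3 = h0" using h_pos by simp
  moreover have "h0 * h1 * h2 * h3 / (?k0 * h2 * (?k0 * h3)) / ?k0 =
      h0 * h1 * h2 * h3 / (?k0^3 * h2 * h3)"
    by (simp add: power3_eq_cube mult_ac)
  moreover have "h0 * h1 * h2 * h3 / (h0 * h2 * h3) = h1"
    "?k0 * h2 / ?k0 = h2" "?k0 * h3 / ?k0 = h3"
    using h_pos by simp_all
  ultimately show thesis using that by metis
qed

theorem theorem5p21:
  fixes h0 h1 h2 h3 :: real
  assumes "h0 > 0" "h1 > 0" "h2 > 0" "h3 > 0"
    and "h1 \<le> h2" "h2 \<le> h3"
    and "D_infty h0 h1 h2 h3"
  shows "(\<exists>g0 g1 g2 g3. S3_solution h0 h1 h2 h3 {0..} g0 g1 g2 g3) \<and>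
         (\<forall>g0 g1 g2 g3. S3_solution h0 h1 h2 h3 {0..} g0 g1 g2 g3 \<longrightarrow>
            (g0 \<longlongrightarrow> 0) at_top \<and> (g1 \<longlongrightarrow> 0) at_top \<and>
            filterlim g2 at_top at_top \<and> filterlim g3 at_top at_top \<and>
            ((\<lambda>t. g3 t - g2 t) \<longlongrightarrow> 0) at_top)"
proof -
  obtain g0 g1 g2 g3
    where sol: "S3_solution h0 h1 h2 h3 {0..} g0 g1 g2 g3" and lim: "collapses g0 g1 g2 g3"
    using D_infty_collapsing_S3_solution assms by blast
  have "collapses g0' g1' g2' g3'" if "S3_solution h0 h1 h2 h3 {0..} g0' g1' g2' g3'"
    for g0' g1' g2' g3'
    using S3_solution_unique[OF sol that] lim by (rule collapses_cong)
  with sol show ?thesis unfolding collapses_def by blast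
qed

end
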